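(* Let $G$ be a finite graph (loops and multiple edges allowed) with a fixed orientation, $\mathbb{F}$ a field, and $\boldsymbol b_1,\boldsymbol b_2\in B(G,\mathbb{F})$. (a) If $\boldsymbol b_1,\boldsymbol b_2\in M(\mathcal{A}_{\tilde{\Pi}(G)}/\tilde{X})$ for some flat $\tilde{X}\in L(\mathcal{A}_{\tilde{\Pi}(G)})$, then $$L(\tilde{\mathcal{A}}_{E(G)}^{\boldsymbol b_1})\cong L(\tilde{\mathcal{A}}_{E(G)}^{\boldsymbol b_2})\ \text{(as posets)},\qquad \tilde{\Pi}_{\boldsymbol b_1}=\tilde{\Pi}_{\boldsymbol b_2},$$ and $$\chi(\tilde{\mathcal{A}}_{E(G)}^{\boldsymbol b_1},t)=\chi(\tilde{\mathcal{A}}_{E(G)}^{\boldsymbol b_2},t)=\varphi_G(\tilde{\Pi}_{\boldsymbol b_1},t)=\varphi_G(\tilde{\Pi}_{\boldsymbol b_2},t).$$ (b) If $\boldsymbol b_1,\boldsymbol b_2\in M(\mathcal{A}_{\Pi(G)}/X)$ for some flat $X\in L(\mathcal{A}_{\Pi(G)})$, then $$L(\mathcal{A}_{E(G)}^{\boldsymbol b_1})\cong L(\mathcal{A}_{E(G)}^{\boldsymbol b_2})\ \text{(as posets)},\qquad \Pi_{\boldsymbol b_1}=\Pi_{\boldsymbol b_2},$$ and $$\chi(\mathcal{A}_{E(G)}^{\boldsymbol b_1},t)=\chi(\mathcal{A}_{E(G)}^{\boldsymbol b_2},t)=\varphi_G(\Pi_{\boldsymbol b_1},t)=\varphi_G(\Pi_{\boldsymbol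 b_2},t).$$
   Context: Graph notation. For $S\subseteq E(G)$: $S^c=E(G)\smallsetminus S$; $c(S)$ is the number of components of $(V(G),S)$; $n(S)=|S|-|V(G)|+c(S)$. $\pi(S)$ is the partition of $V(G)$ into vertex sets of components of $(V(G),S)$; $\Pi(G)=\{\pi(S):S\subseteq E(G)\}$. $E_{\rm cut}(G)$ is the set of cut-edges (edges contained in no cycle; loops are cycles). $\tilde\Pi(G)=\{\pi(S)\in\Pi(G):E_{\rm cut}(G)\subseteq S\}$. For $\mathfrak{p}\subseteq\Pi(G)$, $\varphi_G(\mathfrak{p},t)=\sum_{S\subseteq E(G),\,\pi(S)\in\mathfrak{p}}(-1)^{|S^c|}t^{n(S)}$. Affine flows. The boundary operator $\partial:\mathbb{F}^{E(G)}\to\mathbb{F}^{V(G)}$ is $\partial\boldsymbol c(v)=\sum_{e\in E^+(v)}\boldsymbol c(e)-\sum_{e\in E^-(v)}\boldsymbol c(e)$, where $E^+(v)$ (resp. $E^-(v)$) is the set of edges with head (resp. tail) $v$ (loops contribute $0$). $B(G,\mathbb{F})=\partial(\mathbb{F}^{E(G)})$ and $F(G,\boldsymbol b;\mathbb{F})=\{\boldsymbol c\in\mathbb{F}^{E(G)}:\partial\boldsymbol c=\boldsymbol b\}$. For $\pi\in\Pi(G)$, $B_\pi=\{\boldsymbol x\in\mathbb{F}^{V(G)}:\sum_{v\in U}\boldsymbol x(v)=0\text{ for every block }U\in\pi\}$, a subspace of $B(G,\mathbb{F})$. $\Pi_{\boldsymbol b}=\{\pi\in\Pi(G):\boldsymbol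 b\in B_\pi\}$ and $\tilde\Pi_{\boldsymbol b}=\{\pi\in\tilde\Pi(G):\boldsymbol b\in B_\pi\}$. Arrangements. For a finite set $\mathcal{A}$ of affine subspaces of an affine space $V$ over $\mathbb{F}$: $\chi(\mathcal{A},t)=\sum_{\mathcal{B}\subseteq\mathcal{A},\,\bigcap_{H\in\mathcal{B}}H\neq\emptyset}(-1)^{|\mathcal{B}|}t^{\dim\bigcap_{H\in\mathcal{B}}H}$; $L(\mathcal{A})$ is the poset of all nonempty intersections of members of $\mathcal{A}$ (including $V$ as the empty intersection), ordered by reverse inclusion, whose elements are called flats; $M(\mathcal{A})=V\smallsetminus\bigcup_{H\in\mathcal{A}}H$. For a flat $X$, the restriction $\mathcal{A}/X=\{H\cap X\neq\emptyset:H\in\mathcal{A},\,X\nsubseteq H\}$ is an arrangement in $X$ (so $M(\mathcal{A}/X)\subseteq X$). Let $H_e=\{\boldsymbol x\in\mathbb{F}^{E(G)}:\boldsymbol x(e)=0\}$ and $H_e^{\boldsymbol b}=H_e\cap F(G,\boldsymbol b;\mathbb{F})$. $\mathcal{A}_{E(G)}^{\boldsymbol b}=\{H_e^{\boldsymbol b}:e\in E(G),H_e^{\boldsymbol b}\neq\emptyset\}$, an arrangement in $F(G,\boldsymbol b;\mathbb{F})$ (possibly containing the whole space), and $\tilde{\mathcal{A}}_{E(G)}^{\boldsymbol b}=\mathcal{A}_{E(G)}^{\boldsymbol b}\smallsetminus\{F(G,\boldsymbol b;\mathbb{F})\}$. Boundary arrangements (hyperplane arrangements in $B(G,\mathbb{F})$;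 $|\pi|$ is the number of blocks): $\mathcal{A}_{\Pi(G)}=\{B_\pi:\pi\in\Pi(G),|\pi|=|\pi(E(G))|+1\}$ and $\mathcal{A}_{\tilde\Pi(G)}=\{B_\pi:\pi\in\tilde\Pi(G),|\pi|=|\pi(E(G))|+1\}$. *)

theory Defs
  imports
    "Graph_Theory.Digraph_Component"
    "HOL-Library.Function_Algebras"
    "HOL-Computational_Algebra.Polynomial"
begin

text \<open>
  A finite graph (loops and multiple edges allowed) with a fixed orientation is a
  \<open>fin_digraph\<close>: its arcs are the edges, each with a chosen tail and head. Only the boundary
  operator refers to the orientation; cycles and components are those of the underlying
  undirected multigraph.
\<close>

section \<open>Graphs\<close>

text \<open>
  The list \<open>es\<close> consists of \<open>k \<ge> 1\<close> distinct edges and \<open>vs\<close> of \<open>k\<close> distinct vertices; the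
  \<open>i\<close>-th edge joins the \<open>i\<close>-th and the \<open>(i+1 mod k)\<close>-th vertex. So \<open>k = 1\<close> is a loop and
  \<open>k = 2\<close> a pair of parallel edges.
\<close>
definition undirected_cycle :: "('v,'e) pre_digraph \<Rightarrow> 'v list \<Rightarrow> 'e list \<Rightarrow> bool" where
  "undirected_cycle G vs es \<longleftrightarrow>
     es \<noteq> [] \<and> length vs = length es \<and> distinct vs \<and> distinct es \<and> set es \<subseteq> arcs G \<and>
     (\<forall>i<length es. {tail G (es ! i), head G (es ! i)} = {vs ! i, vs ! (Suc i mod length es)})"

definition cut_edges :: "('v,'e) pre_digraph \<Rightarrow> 'e set" where
  "cut_edges G = {e \<in> arcs G. \<not> (\<exists>vs es. undirected_cycle G vs es \<and> e \<in> set es)}"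

definition comp_partition :: "('v,'e) pre_digraph \<Rightarrow> 'e set \<Rightarrow> 'v set set" where
  "comp_partition G S =
     verts G // {(u, v). u \<rightarrow>\<^sup>*\<^bsub>with_proj (mk_symmetric (G\<lparr>arcs := S\<rparr>))\<^esub> v}"

definition num_comps :: "('v,'e) pre_digraph \<Rightarrow> 'e set \<Rightarrow> nat" where
  "num_comps G S = card (comp_partition G S)"

text \<open>The natural subtraction does not truncate: \<open>|V(G)| \<le> |S| + c(S)\<close> always holds.\<close>
definition nullity :: "('v,'e) pre_digraph \<Rightarrow> 'e set \<Rightarrow> nat" where
  "nullity G S = (card S + num_comps G S) - card (verts G)"

definition Partitions :: "('v,'e) pre_digraph \<Rightarrow> 'v set set set" where
  "Partitions G = {comp_partition G S | S. S \<subseteq> arcs G}"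

definition Partitions_cut :: "('v,'e) pre_digraph \<Rightarrow> 'v set set set" where
  "Partitions_cut G = {comp_partition G S | S. S \<subseteq> arcs G \<and> cut_edges G \<subseteq> S}"

definition phi :: "('v,'e) pre_digraph \<Rightarrow> 'v set set set \<Rightarrow> int poly" where
  "phi G P = (\<Sum>S | S \<subseteq> arcs G \<and> comp_partition G S \<in> P.
      monom ((- 1) ^ card (arcs G - S)) (nullity G S))"

section \<open>Coordinate spaces and affine dimension\<close>

text \<open>The space \<open>F^I\<close>, realised as the functions that vanish outside \<open>I\<close>.\<close>
definition coord_space :: "'i set \<Rightarrow> ('i \<Rightarrow> 'f::field) set" where
  "coord_space I = {x. \<forall>i. i \<notin> I \<longrightarrow> x i = 0}"

definition fun_scale :: "'f::field \<Rightarrow> ('i \<Rightarrow> 'f) \<Rightarrow> ('i \<Rightarrow> 'f)" where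
  "fun_scale a x = (\<lambda>i. a * x i)"

global_interpretation fun_space: vector_space "fun_scale :: 'f::field \<Rightarrow> ('i \<Rightarrow> 'f) \<Rightarrow> _"
  by unfold_locales (auto simp: fun_scale_def fun_eq_iff algebra_simps)

text \<open>Dimension of a nonempty affine subspace: that of its space of directions.\<close>
definition aff_dimension :: "('i \<Rightarrow> 'f::field) set \<Rightarrow> nat" where
  "aff_dimension A = fun_space.dim {x - y | x y. x \<in> A \<and> y \<in> A}"

section \<open>Arrangements\<close>

text \<open>
  An arrangement \<open>A\<close> is a finite set of affine subspaces of an affine space \<open>V\<close>. The ambient
  space is an explicit argument; intersecting with it makes \<open>V\<close> the empty intersection.
\<close>

definition arr_chi :: "('i \<Rightarrow> 'f::field) set \<Rightarrow> ('i \<Rightarrow> 'f) set set \<Rightarrow> int poly" where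
  "arr_chi V A = (\<Sum>B | B \<subseteq> A \<and> V \<inter> \<Inter>B \<noteq> {}.
      monom ((- 1) ^ card B) (aff_dimension (V \<inter> \<Inter>B)))"

definition arr_flats :: "'a set \<Rightarrow> 'a set set \<Rightarrow> 'a set set" where
  "arr_flats V A = {V \<inter> \<Inter>B | B. B \<subseteq> A \<and> V \<inter> \<Inter>B \<noteq> {}}"

definition arr_compl :: "'a set \<Rightarrow> 'a set set \<Rightarrow> 'a set" where
  "arr_compl V A = V - \<Union>A"

definition arr_restrict :: "'a set set \<Rightarrow> 'a set \<Rightarrow> 'a set set" where
  "arr_restrict A X = {H \<inter> X | H. H \<in> A \<and> \<not> X \<subseteq> H \<and> H \<inter> X \<noteq> {}}"

text \<open>Isomorphism of two families of sets as posets under reverse inclusion.\<close>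
definition rev_incl_isomorphic :: "'a set set \<Rightarrow> 'b set set \<Rightarrow> bool" where
  "rev_incl_isomorphic L L' \<longleftrightarrow>
     (\<exists>f. bij_betw f L L' \<and> (\<forall>X\<in>L. \<forall>Y\<in>L. X \<supseteq> Y \<longleftrightarrow> f X \<supseteq> f Y))"

section \<open>Affine flows and boundary arrangements\<close>

text \<open>A loop at \<open>v\<close> is both an in-arc and an out-arc of \<open>v\<close>, so it contributes \<open>0\<close>.\<close>
definition boundary :: "('v,'e) pre_digraph \<Rightarrow> ('e \<Rightarrow> 'f::field) \<Rightarrow> 'v \<Rightarrow> 'f" where
  "boundary G c v = (\<Sum>e\<in>in_arcs G v. c e) - (\<Sum>e\<in>out_arcs G v. c e)"

definition boundaries :: "('v,'e) pre_digraph \<Rightarrow> ('v \<Rightarrow> 'f::field) set" where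
  "boundaries G = boundary G ` coord_space (arcs G)"

definition flows :: "('v,'e) pre_digraph \<Rightarrow> ('v \<Rightarrow> 'f::field) \<Rightarrow> ('e \<Rightarrow> 'f) set" where
  "flows G b = {c \<in> coord_space (arcs G). boundary G c = b}"

definition B_part :: "('v,'e) pre_digraph \<Rightarrow> 'v set set \<Rightarrow> ('v \<Rightarrow> 'f::field) set" where
  "B_part G p = {x \<in> coord_space (verts G). \<forall>U\<in>p. (\<Sum>v\<in>U. x v) = 0}"

definition Partitions_at ::
    "('v,'e) pre_digraph \<Rightarrow> ('v \<Rightarrow> 'f::field) \<Rightarrow> 'v set set set" where
  "Partitions_at G b = {p \<in> Partitions G. b \<in> B_part G p}"

definition Partitions_cut_at ::
    "('v,'e) pre_digraph \<Rightarrow> ('v \<Rightarrow> 'f::field) \<Rightarrow> 'v set set set" where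
  "Partitions_cut_at G b = {p \<in> Partitions_cut G. b \<in> B_part G p}"

definition coord_hyperplane :: "('v,'e) pre_digraph \<Rightarrow> 'e \<Rightarrow> ('e \<Rightarrow> 'f::field) set" where
  "coord_hyperplane G e = {x \<in> coord_space (arcs G). x e = 0}"

definition flow_arr ::
    "('v,'e) pre_digraph \<Rightarrow> ('v \<Rightarrow> 'f::field) \<Rightarrow> ('e \<Rightarrow> 'f) set set" where
  "flow_arr G b = {coord_hyperplane G e \<inter> flows G b | e.
      e \<in> arcs G \<and> coord_hyperplane G e \<inter> flows G b \<noteq> {}}"

definition flow_arr_proper ::
    "('v,'e) pre_digraph \<Rightarrow> ('v \<Rightarrow> 'f::field) \<Rightarrow> ('e \<Rightarrow> 'f) set set" where
  "flow_arr_proper G b = flow_arr G b - {flows G b}"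

definition boundary_arr :: "('v,'e) pre_digraph \<Rightarrow> ('v \<Rightarrow> 'f::field) set set" where
  "boundary_arr G = {B_part G p | p.
      p \<in> Partitions G \<and> card p = card (comp_partition G (arcs G)) + 1}"

definition boundary_arr_cut :: "('v,'e) pre_digraph \<Rightarrow> ('v \<Rightarrow> 'f::field) set set" where
  "boundary_arr_cut G = {B_part G p | p.
      p \<in> Partitions_cut G \<and> card p = card (comp_partition G (arcs G)) + 1}"

end

theory Submission
  imports Defs
begin

text \<open>
  Everything is read off from one question: for which edge sets \<open>S\<close> does \<open>b\<close> have a flow supported
  on \<open>S\<close>? Such a flow exists exactly if the entries of \<open>b\<close> sum to zero on every component of \<open>S\<close>
  (\<open>B_part_comp_partition_iff\<close>), so the partitions \<open>\<pi>(S)\<close> with \<open>b \<in> B\<^bsub>\<pi>(S)\<^esub>\<close> record the answer.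
  The flows with boundary \<open>b\<close> that vanish on an edge set \<open>T\<close> are those supported on the
  complement of \<open>T\<close>; these sets, when nonempty, are the flats of the arrangement of coordinate
  hyperplanes.

  The flats. A nonempty flat is a translate of the space of circulations on its support, which
  depends on \<open>G\<close> only. Hence inclusion between two flats can be decided from the graph and from the
  answers to the question above (\<open>flows_on_subset_iff\<close>), and two boundaries with the same answers
  have isomorphic posets of flats.

  The polynomials. The circulations on \<open>S\<close> form a space of dimension \<open>n(S)\<close>
  (\<open>aff_dimension_flows_on\<close>), so summing over edge sets \<open>T\<close> and substituting \<open>S = T\<^sup>c\<close> gives
  \<open>\<phi>\<close>. The characteristic polynomial sums over sets of hyperplanes instead, and distinct
  edges can define the same hyperplane; the alternating signs make the multiplicities cancel
  (\<open>signed_sum_Pow_image\<close>).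

  The boundary arrangement. Two points in the complement of the same restriction lie on the same
  boundary hyperplanes. These hyperplanes decide membership in every \<open>B\<^bsub>\<pi>(S)\<^esub>\<close>
  (\<open>flow_from_corank_one\<close>): extend \<open>S\<close> minimally by \<open>T\<close> to an edge set with the components of
  \<open>G\<close>; removing one \<open>e \<in> T\<close> produces exactly one more component, hence a boundary hyperplane, and
  since \<open>e\<close> is then a bridge of \<open>S \<union> T\<close>, lying on that hyperplane forces every flow on \<open>S \<union> T\<close>
  with boundary \<open>b\<close> to vanish at \<open>e\<close>.

  The two halves of the theorem are the same argument for two families of edge sets: all \<open>S\<close>, or
  only those containing the cut-edges. On a cut-edge all flows with boundary \<open>b\<close> agree, so its
  hyperplane is empty or the whole space; on any other edge a circulation changes the value, so its
  hyperplane is proper. Discarding the whole space from the arrangement is thus the same as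
  restricting to edges that are not cut-edges (\<open>flow_arr_proper_eq_edge_arr\<close>).
\<close>

section \<open>Signed sums over subsets of an indexed family\<close>

lemma sum_Pow_insert_split:
  fixes f :: "'a set \<Rightarrow> 'r::comm_monoid_add"
  assumes "finite A" "a \<notin> A"
  shows "(\<Sum>B\<in>Pow (insert a A). f B) = (\<Sum>B\<in>Pow A. f B) + (\<Sum>B\<in>Pow A. f (insert a B))"
proof -
  have "inj_on (insert a) (Pow A)"
    using assms(2) by (auto simp: inj_on_def)
  moreover have "Pow A \<inter> insert a ` Pow A = {}"
    using assms(2) by auto
  ultimately show ?thesis
    using assms(1) by (simp add: Pow_insert sum.union_disjoint sum.reindex)
qed

text \<open>
  Toggling \<open>a\<close> in \<open>B\<close> flips the sign and leaves \<open>insert a B\<close> unchanged.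
\<close>
lemma signed_sum_Pow_absorbed:
  fixes g :: "'a set \<Rightarrow> 'r::comm_ring_1"
  assumes "finite A" "a \<in> A"
  shows "(\<Sum>B\<in>Pow A. (- 1) ^ card B * g (insert a B)) = 0"
proof -
  obtain A' where A': "A = insert a A'" "a \<notin> A'"
    using assms(2) by (meson Set.set_insert)
  have fin: "finite A'"
    using assms(1) A'(1) by simp
  have "card (insert a B) = Suc (card B)" if "B \<in> Pow A'" for B
    using that A'(2) fin by (metis PowD card_insert_disjoint finite_subset subsetD)
  then show ?thesis
    unfolding A'(1) by (simp add: sum_Pow_insert_split[OF fin A'(2)] sum_negf)
qed

text \<open>
  Passing from edges to hyperplanes loses multiplicities. Nothing changes in a signed sum, because
  the nonempty subsets of a fibre of \<open>h\<close> contribute the total sign \<open>-1\<close>, as a single element does.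
\<close>
lemma signed_sum_Pow_image:
  fixes g :: "'b set \<Rightarrow> 'r::comm_ring_1"
  assumes "finite K"
  shows "(\<Sum>B\<in>Pow (h ` K). (- 1) ^ card B * g B) = (\<Sum>T\<in>Pow K. (- 1) ^ card T * g (h ` T))"
  using assms
proof (induction K arbitrary: g)
  case empty
  then show ?case by simp
next
  case (insert e K)
  have card_ins: "card (insert e T) = Suc (card T)" if "T \<in> Pow K" for T
    using that insert.hyps by (metis PowD card_insert_disjoint finite_subset subsetD)
  have "(\<Sum>T\<in>Pow (insert e K). (- 1) ^ card T * g (h ` T))
      = (\<Sum>T\<in>Pow K. (- 1) ^ card T * g (h ` T))
        - (\<Sum>T\<in>Pow K. (- 1) ^ card T * g (insert (h e) (h ` T)))"
    using card_ins by (simp add: sum_Pow_insert_split[OF insert.hyps] sum_negf)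
  also have "\<dots> = (\<Sum>B\<in>Pow (h ` K). (- 1) ^ card B * g B)
        - (\<Sum>B\<in>Pow (h ` K). (- 1) ^ card B * g (insert (h e) B))"
    using insert.IH[of g] insert.IH[of "\<lambda>B. g (insert (h e) B)"] by simp
  also have "\<dots> = (\<Sum>B\<in>Pow (h ` insert e K). (- 1) ^ card B * g B)"
  proof (cases "h e \<in> h ` K")
    case True
    then show ?thesis
      using insert.hyps(1) by (simp add: signed_sum_Pow_absorbed insert_absorb)
  next
    case False
    have fin: "finite (h ` K)"
      using insert.hyps(1) by simp
    have "card (insert (h e) B) = Suc (card B)" if "B \<in> Pow (h ` K)" for B
      using that False fin by (metis PowD card_insert_disjoint finite_subset subsetD)
    then show ?thesis
      by (simp add: sum_Pow_insert_split[OF fin False] sum_negf)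
  qed
  finally show ?case by simp
qed

section \<open>Connectedness in spanning subgraphs\<close>

text \<open>
  The blocks of \<open>comp_partition G S\<close> are the classes of the equivalence \<open>joined G S\<close>. Being a plain
  reflexive-transitive closure on the whole vertex type, it is an equivalence for every \<open>S\<close> and
  makes the effect of adding an edge explicit.
\<close>
definition links :: "('v,'e) pre_digraph \<Rightarrow> 'e set \<Rightarrow> 'v rel" where
  "links G S = (\<Union>e\<in>S. {(tail G e, head G e), (head G e, tail G e)})"

definition joined :: "('v,'e) pre_digraph \<Rightarrow> 'e set \<Rightarrow> 'v rel" where
  "joined G S = (links G S)\<^sup>*"

lemma sym_links: "sym (links G S)"
  by (auto simp: links_def sym_def)

lemma joined_refl [simp]: "(u, u) \<in> joined G S"
  by (simp add: joined_def)

lemma joined_sym: "(u, v) \<in> joined G S \<Longrightarrow> (v, u) \<in> joined G S"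
  unfolding joined_def using sym_links sym_rtrancl symD by metis

lemma joined_trans: "(u, v) \<in> joined G S \<Longrightarrow> (v, w) \<in> joined G S \<Longrightarrow> (u, w) \<in> joined G S"
  unfolding joined_def by (rule rtrancl_trans)

lemma joined_mono: "S \<subseteq> S' \<Longrightarrow> joined G S \<subseteq> joined G S'"
  unfolding joined_def by (intro rtrancl_mono) (auto simp: links_def)

lemma joined_edge: "e \<in> S \<Longrightarrow> (tail G e, head G e) \<in> joined G S"
  unfolding joined_def by (rule r_into_rtrancl) (auto simp: links_def)

lemma joined_empty: "joined G {} = Id"
  by (simp add: joined_def links_def)

lemma equiv_joined: "equiv UNIV (joined G S)"
  by (intro equivI refl_onI symI transI) (auto intro: joined_sym dest: joined_trans)

lemma joined_class_eq_iff: "joined G S `` {u} = joined G S `` {v} \<longleftrightarrow> (u, v) \<in> joined G S"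
  using eq_equiv_class_iff[OF equiv_joined] by simp

lemma joined_insert:
  "(u, v) \<in> joined G (insert e S) \<longleftrightarrow>
     (u, v) \<in> joined G S \<or>
     (u, tail G e) \<in> joined G S \<and> (head G e, v) \<in> joined G S \<or>
     (u, head G e) \<in> joined G S \<and> (tail G e, v) \<in> joined G S"
  (is "_ \<longleftrightarrow> ?R u v")
proof
  assume "(u, v) \<in> joined G (insert e S)"
  then have "(u, v) \<in> (links G (insert e S))\<^sup>*"
    by (simp add: joined_def)
  then show "?R u v"
  proof (induction rule: rtrancl_induct)
    case base
    then show ?case by simp
  next
    case (step y z)
    consider "(y, z) \<in> joined G S" | "y = tail G e" "z = head G e" | "y = head G e" "z = tail G e"
      using step.hyps(2) by (auto simp: links_def joined_def intro: r_into_rtrancl)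
    then show ?case
      using step.IH by cases (meson joined_refl joined_sym joined_trans)+
  qed
next
  have "joined G S \<subseteq> joined G (insert e S)"
    by (rule joined_mono) auto
  moreover have "(tail G e, head G e) \<in> joined G (insert e S)"
    by (rule joined_edge) simp
  moreover assume "?R u v"
  ultimately show "(u, v) \<in> joined G (insert e S)"
    by (meson joined_sym joined_trans subsetD)
qed

lemma joined_insert_redundant:
  assumes "(tail G e, head G e) \<in> joined G S"
  shows "joined G (insert e S) = joined G S"
proof -
  have "(u, v) \<in> joined G (insert e S) \<longleftrightarrow> (u, v) \<in> joined G S" for u v
    using assms by (meson joined_insert joined_sym joined_trans)
  then show ?thesis by auto
qed

context fin_digraph
begin

lemma joined_in_verts:
  assumes "S \<subseteq> arcs G" "(u, v) \<in> joined G S" "u \<in> verts G"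
  shows "v \<in> verts G"
  using assms(2,3) unfolding joined_def
  by (induction rule: rtrancl_induct) (use assms(1) in \<open>auto simp: links_def\<close>)

lemma comp_partition_eq_classes:
  assumes "S \<subseteq> arcs G"
  shows "comp_partition G S = (\<lambda>v. joined G S `` {v}) ` verts G"
proof -
  let ?R = "{(u, v). u \<rightarrow>\<^sup>*\<^bsub>with_proj (mk_symmetric (G\<lparr>arcs := S\<rparr>))\<^esub> v}"
  have R: "(u, v) \<in> ?R \<longleftrightarrow> (u, v) \<in> rtrancl_on (verts G) (links G S)" for u v
    by (simp add: reachable_def mk_symmetric_def links_def arcs_ends_def arc_to_ends_def)
  have "(u, v) \<in> rtrancl_on (verts G) (links G S)" if "(u, v) \<in> joined G S" "u \<in> verts G" for u v
    using that(1) unfolding joined_def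
  proof (induction rule: rtrancl_induct)
    case base
    then show ?case using that(2) by simp
  next
    case (step y z)
    then have "z \<in> verts G"
      using assms by (auto simp: links_def)
    then show ?case
      using step by (meson rtrancl_on_into_rtrancl_on)
  qed
  then have "?R `` {u} = joined G S `` {u}" if "u \<in> verts G" for u
    using that R unfolding joined_def by (blast intro: rtrancl_on_rtranclI)
  then show ?thesis
    by (auto simp: comp_partition_def quotient_def)
qed

lemma joined_iff_same_block:
  assumes "S \<subseteq> arcs G" "u \<in> verts G"
  shows "(u, v) \<in> joined G S \<longleftrightarrow> (\<exists>U\<in>comp_partition G S. u \<in> U \<and> v \<in> U)"
proof
  assume "(u, v) \<in> joined G S"
  then show "\<exists>U\<in>comp_partition G S. u \<in> U \<and> v \<in> U"
    using assms(2) unfolding comp_partition_eq_classes[OF assms(1)]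
    by (intro bexI[of _ "joined G S `` {u}"]) simp_all
next
  assume "\<exists>U\<in>comp_partition G S. u \<in> U \<and> v \<in> U"
  then obtain w where "(w, u) \<in> joined G S" "(w, v) \<in> joined G S"
    using assms by (auto simp: comp_partition_eq_classes)
  then show "(u, v) \<in> joined G S"
    by (meson joined_sym joined_trans)
qed

lemma comp_partition_block_subset:
  assumes "S \<subseteq> arcs G" "U \<in> comp_partition G S"
  shows "U \<subseteq> verts G"
  using assms by (auto simp: comp_partition_eq_classes intro: joined_in_verts)

text \<open>
  The new edge merges the class of its tail with the class of its head and keeps all others.
\<close>
lemma card_comp_partition_insert:
  assumes "insert e S \<subseteq> arcs G" "(tail G e, head G e) \<notin> joined G S"
  shows "card (comp_partition G S) = card (comp_partition G (insert e S)) + 1"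
proof -
  have S: "S \<subseteq> arcs G" and e: "tail G e \<in> verts G" "head G e \<in> verts G"
    using assms(1) by auto
  let ?t = "joined G S `` {tail G e}" and ?h = "joined G S `` {head G e}"
  have ne: "?t \<noteq> ?h"
    using assms(2) by (simp add: joined_class_eq_iff)
  have cls: "joined G (insert e S) `` {v} = (if v \<in> ?t \<union> ?h then ?t \<union> ?h else joined G S `` {v})" for v
  proof -
    have "w \<in> joined G (insert e S) `` {v} \<longleftrightarrow>
        w \<in> (if v \<in> ?t \<union> ?h then ?t \<union> ?h else joined G S `` {v})" for w
      unfolding Image_singleton_iff joined_insert
      by (simp, meson joined_sym joined_trans)
    then show ?thesis by blast
  qed
  have same: "joined G S `` {v} = ?t \<longleftrightarrow> v \<in> ?t" "joined G S `` {v} = ?h \<longleftrightarrow> v \<in> ?h" for v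
    by (simp_all add: joined_class_eq_iff) (meson joined_sym)+
  have "?t \<union> ?h = joined G (insert e S) `` {tail G e}"
    unfolding cls by simp
  then have merge: "comp_partition G (insert e S) = insert (?t \<union> ?h) (comp_partition G S - {?t, ?h})"
    unfolding comp_partition_eq_classes[OF assms(1)] comp_partition_eq_classes[OF S]
  proof -
    have "(\<lambda>v. joined G (insert e S) `` {v}) ` (verts G \<inter> (?t \<union> ?h)) = {?t \<union> ?h}"
      using e by (auto simp del: Un_iff Image_singleton_iff simp: cls intro!: image_eqI[of _ _ "tail G e"])
    moreover have "(\<lambda>v. joined G (insert e S) `` {v}) ` (verts G - (?t \<union> ?h))
        = (\<lambda>v. joined G S `` {v}) ` (verts G - (?t \<union> ?h))"
      unfolding cls by (intro image_cong refl) (simp only: Diff_iff if_False)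
    moreover have "\<dots> = (\<lambda>v. joined G S `` {v}) ` verts G - {?t, ?h}"
      using same by blast
    moreover have "verts G = verts G \<inter> (?t \<union> ?h) \<union> (verts G - (?t \<union> ?h))"
      by blast
    ultimately show "(\<lambda>v. joined G (insert e S) `` {v}) ` verts G
        = insert (?t \<union> ?h) ((\<lambda>v. joined G S `` {v}) ` verts G - {?t, ?h})"
      by (metis (no_types, lifting) image_Un insert_is_Un)
  qed
  have fin: "finite (comp_partition G S)"
    by (simp add: comp_partition_eq_classes[OF S])
  have th: "?t \<in> comp_partition G S" "?h \<in> comp_partition G S"
    using e by (auto simp: comp_partition_eq_classes[OF S])
  have new: "?t \<union> ?h \<notin> comp_partition G S - {?t, ?h}"
  proof
    assume "?t \<union> ?h \<in> comp_partition G S - {?t, ?h}"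
    then obtain v where v: "?t \<union> ?h = joined G S `` {v}" "?t \<union> ?h \<noteq> ?t"
      by (auto simp: comp_partition_eq_classes[OF S])
    then have "tail G e \<in> joined G S `` {v}"
      by (metis ImageI UnCI joined_refl singletonI)
    then show False
      using v by (metis Image_singleton_iff joined_class_eq_iff)
  qed
  have "card {?t, ?h} \<le> card (comp_partition G S)"
    by (rule card_mono) (use fin th in auto)
  moreover have "card (comp_partition G S - {?t, ?h}) = card (comp_partition G S) - 2"
    using th ne by (subst card_Diff_subset) auto
  ultimately show ?thesis
    using merge new fin ne by simp
qed

end

section \<open>Flows supported on a set of edges\<close>

definition flows_on ::
    "('v,'e) pre_digraph \<Rightarrow> 'e set \<Rightarrow> ('v \<Rightarrow> 'f::field) \<Rightarrow> ('e \<Rightarrow> 'f) set" where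
  "flows_on G S b = {c \<in> coord_space S. boundary G c = b}"

abbreviation cycle_space :: "('v,'e) pre_digraph \<Rightarrow> 'e set \<Rightarrow> ('e \<Rightarrow> 'f::field) set" where
  "cycle_space G S \<equiv> flows_on G S (\<lambda>_. 0)"

lemma flows_on_arcs: "flows_on G (arcs G) b = flows G b"
  by (simp add: flows_on_def flows_def)

lemma flows_on_mono: "S \<subseteq> S' \<Longrightarrow> flows_on G S b \<subseteq> flows_on G S' b"
  by (auto simp: flows_on_def coord_space_def)

lemma flows_on_Int: "flows_on G S b \<inter> flows_on G S' b = flows_on G (S \<inter> S') b"
  by (auto simp: flows_on_def coord_space_def)

context fin_digraph
begin

lemma boundary_eq_sum:
  "boundary G c v = (\<Sum>e\<in>arcs G. c e * (of_bool (head G e = v) - of_bool (tail G e = v)))"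
proof -
  have "(\<Sum>e\<in>in_arcs G v. c e) = (\<Sum>e\<in>arcs G. c e * of_bool (head G e = v))"
    and "(\<Sum>e\<in>out_arcs G v. c e) = (\<Sum>e\<in>arcs G. c e * of_bool (tail G e = v))"
    by (rule sum.mono_neutral_cong_left; force)+
  then show ?thesis
    by (simp add: boundary_def sum_subtractf right_diff_distrib)
qed

lemma boundary_combine:
  "boundary G (\<lambda>e. x e + a * y e) = (\<lambda>v. boundary G x v + a * boundary G y v)"
  by (simp add: boundary_eq_sum fun_eq_iff sum.distrib sum_distrib_left distrib_right mult.assoc)

lemma boundary_zero: "boundary G (\<lambda>_. 0) = (\<lambda>_. 0)"
  by (simp add: boundary_eq_sum fun_eq_iff)

lemma boundary_unit:
  assumes "e \<in> arcs G"
  shows "boundary G (\<lambda>e'. of_bool (e' = e)) = (\<lambda>v. of_bool (v = head G e) - of_bool (v = tail G e))"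
proof
  fix v
  have "boundary G (\<lambda>e'. of_bool (e' = e)) v
      = (\<Sum>e'\<in>arcs G. if e' = e then of_bool (head G e' = v) - of_bool (tail G e' = v) else 0)"
    unfolding boundary_eq_sum by (rule sum.cong) auto
  then show "boundary G (\<lambda>e'. of_bool (e' = e)) v = of_bool (v = head G e) - of_bool (v = tail G e)"
    using assms by (simp add: sum.delta eq_commute)
qed

lemma boundary_outside: "v \<notin> verts G \<Longrightarrow> boundary G c v = 0"
  by (auto simp: boundary_eq_sum intro!: sum.neutral)

lemma sum_boundary:
  assumes "U \<subseteq> verts G"
  shows "(\<Sum>v\<in>U. boundary G c v)
      = (\<Sum>e\<in>arcs G. c e * (of_bool (head G e \<in> U) - of_bool (tail G e \<in> U)))"
proof -
  have "finite U"
    using assms by (rule finite_subset) simp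
  then have ind: "(\<Sum>v\<in>U. of_bool (w = v)) = (of_bool (w \<in> U) :: 'f::field)" for w
    by (simp add: of_bool_def sum.delta)
  have "(\<Sum>v\<in>U. boundary G c v)
      = (\<Sum>e\<in>arcs G. \<Sum>v\<in>U. c e * (of_bool (head G e = v) - of_bool (tail G e = v)))"
    unfolding boundary_eq_sum by (rule sum.swap)
  also have "\<dots> = (\<Sum>e\<in>arcs G. c e * (of_bool (head G e \<in> U) - of_bool (tail G e \<in> U)))"
    by (simp add: sum_distrib_left[symmetric] sum_subtractf ind)
  finally show ?thesis .
qed

lemma flows_on_combine:
  assumes "x \<in> flows_on G S b" "y \<in> flows_on G S b'"
  shows "(\<lambda>e. x e + a * y e) \<in> flows_on G S (\<lambda>v. b v + a * b' v)"
  using assms by (simp add: flows_on_def coord_space_def boundary_combine)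

text \<open>
  Send one unit along a path from \<open>u\<close> to \<open>v\<close>, with sign \<open>-1\<close> on edges traversed against their
  orientation.
\<close>
lemma path_flow:
  assumes "S \<subseteq> arcs G" "(u, v) \<in> joined G S"
  shows "\<exists>c. c \<in> flows_on G S (\<lambda>w. of_bool (w = v) - of_bool (w = u) :: 'f::field)"
  using assms(2) unfolding joined_def
proof (induction rule: rtrancl_induct)
  case base
  have "(\<lambda>_. 0) \<in> flows_on G S (\<lambda>w. of_bool (w = u) - of_bool (w = u) :: 'f)"
    using boundary_zero by (simp add: flows_on_def coord_space_def fun_eq_iff)
  then show ?case by blast
next
  case (step y z)
  then obtain c where c: "c \<in> flows_on G S (\<lambda>w. of_bool (w = y) - of_bool (w = u) :: 'f)"
    by blast
  obtain e where e: "e \<in> S" "y = tail G e \<and> z = head G e \<or> y = head G e \<and> z = tail G e"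
    using step.hyps(2) by (auto simp: links_def)
  define a :: 'f where "a = (if y = tail G e \<and> z = head G e then 1 else - 1)"
  have "(\<lambda>e'. of_bool (e' = e)) \<in> flows_on G S (\<lambda>w. of_bool (w = head G e) - of_bool (w = tail G e) :: 'f)"
    using e assms(1) boundary_unit[of e] by (auto simp: flows_on_def coord_space_def)
  from flows_on_combine[OF c this, of a]
  have "(\<lambda>e'. c e' + a * of_bool (e' = e)) \<in> flows_on G S (\<lambda>w. of_bool (w = z) - of_bool (w = u))"
    by (rule back_subst[of "\<lambda>b. _ \<in> flows_on G S b"]) (use e(2) in \<open>auto simp: a_def fun_eq_iff\<close>)
  then show ?case by blast
qed

text \<open>
  No edge of \<open>S\<close> leaves a block, so every edge contributes to the sum at both ends or at neither.
\<close>
lemma sum_boundary_over_block: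
  assumes "S \<subseteq> arcs G" "c \<in> coord_space S" "U \<in> comp_partition G S"
  shows "(\<Sum>v\<in>U. boundary G c v) = 0"
proof -
  obtain w where U: "U = joined G S `` {w}"
    using assms(3) unfolding comp_partition_eq_classes[OF assms(1)] by blast
  have "head G e \<in> U \<longleftrightarrow> tail G e \<in> U" if "e \<in> S" for e
    unfolding U Image_singleton_iff using joined_edge[OF that, of G] by (meson joined_sym joined_trans)
  then have "c e * (of_bool (head G e \<in> U) - of_bool (tail G e \<in> U)) = 0" for e
    using assms(2) by (cases "e \<in> S") (auto simp: coord_space_def)
  then show ?thesis
    unfolding sum_boundary[OF comp_partition_block_subset[OF assms(1,3)]] by (intro sum.neutral) blast
qed

text \<open>
  For existence of a flow, choose a root in every block and send \<open>b v\<close> units from the root to \<open>v\<close>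
  along a path, for every \<open>v\<close>. The superposition has boundary \<open>b\<close> away from the roots, and at the
  roots because the sums of \<open>b\<close> over the blocks vanish.
\<close>
lemma B_part_comp_partition_iff:
  fixes b :: "'a \<Rightarrow> 'f::field"
  assumes "S \<subseteq> arcs G"
  shows "b \<in> B_part G (comp_partition G S) \<longleftrightarrow> flows_on G S b \<noteq> {}"
proof
  assume "flows_on G S b \<noteq> {}"
  then obtain c where "c \<in> coord_space S" "boundary G c = b"
    by (auto simp: flows_on_def)
  then show "b \<in> B_part G (comp_partition G S)"
    using sum_boundary_over_block[OF assms, of c] boundary_outside[of _ c]
    by (simp add: B_part_def coord_space_def)
next
  assume b: "b \<in> B_part G (comp_partition G S)"
  define r where "r v = (SOME w. w \<in> joined G S `` {v})" for v
  have r: "(v, r v) \<in> joined G S" for v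
    unfolding r_def using someI[of "\<lambda>w. w \<in> joined G S `` {v}" v] by simp
  have r_cong: "r v = r w" if "(v, w) \<in> joined G S" for v w
    using that unfolding r_def joined_class_eq_iff[symmetric] by (rule arg_cong)
  have r_inj: "(v, w) \<in> joined G S" if "r v = r w" for v w
    using r[of v] joined_sym[OF r[of w]] that by (metis joined_trans)
  have "\<forall>v. \<exists>c. c \<in> flows_on G S (\<lambda>w. of_bool (w = v) - of_bool (w = r v) :: 'f)"
    using path_flow[OF assms joined_sym[OF r]] by blast
  then obtain p where p: "p v \<in> flows_on G S (\<lambda>w. of_bool (w = v) - of_bool (w = r v) :: 'f)" for v
    by metis
  define c where "c e = (\<Sum>v\<in>verts G. b v * p v e)" for e
  have "boundary G c w = b w" for w
  proof -
    have "boundary G c w = (\<Sum>v\<in>verts G. b v * boundary G (p v) w)"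
      unfolding boundary_eq_sum c_def sum_distrib_left sum_distrib_right
      by (subst sum.swap) (simp add: mult.assoc)
    also have "\<dots> = (\<Sum>v\<in>verts G. b v * of_bool (w = v)) - (\<Sum>v\<in>verts G. b v * of_bool (w = r v))"
      using p by (simp add: flows_on_def right_diff_distrib sum_subtractf)
    also have "(\<Sum>v\<in>verts G. b v * of_bool (w = v)) = b w"
    proof -
      have "(\<Sum>v\<in>verts G. b v * of_bool (w = v)) = (\<Sum>v\<in>verts G. if w = v then b v else 0)"
        by (rule sum.cong) auto
      then show ?thesis
        using b by (simp add: B_part_def coord_space_def sum.delta)
    qed
    also have "(\<Sum>v\<in>verts G. b v * of_bool (w = r v)) = (\<Sum>v\<in>{v \<in> verts G. r v = w}. b v)"
      by (rule sum.mono_neutral_cong_right) auto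
    also have "\<dots> = 0"
    proof (cases "{v \<in> verts G. r v = w} = {}")
      case True
      then show ?thesis by (simp only: sum.empty)
    next
      case False
      then obtain v where v: "v \<in> verts G" "r v = w"
        by blast
      have "{v \<in> verts G. r v = w} = joined G S `` {v}"
      proof
        show "{v \<in> verts G. r v = w} \<subseteq> joined G S `` {v}"
          using v(2) r_inj by blast
        show "joined G S `` {v} \<subseteq> {v \<in> verts G. r v = w}"
          using v joined_in_verts[OF assms _ v(1)] r_cong[of v] by auto
      qed
      then show ?thesis
        using b v(1) by (auto simp: B_part_def comp_partition_eq_classes[OF assms])
    qed
    finally show ?thesis by simp
  qed
  moreover have "c \<in> coord_space S"
    using p by (auto simp: c_def coord_space_def flows_on_def intro!: sum.neutral)
  ultimately show "flows_on G S b \<noteq> {}"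
    by (auto simp: flows_on_def fun_eq_iff)
qed

text \<open>
  Close a path avoiding \<open>e\<close> with \<open>e\<close> itself.
\<close>
lemma joined_without_edge_imp_cycle:
  assumes "S \<subseteq> arcs G" "e \<in> S" "(tail G e, head G e) \<in> joined G (S - {e})"
  shows "\<exists>z. z \<in> cycle_space G S \<and> z e = (1::'f::field)"
proof -
  obtain c where c: "c \<in> flows_on G (S - {e}) (\<lambda>w. of_bool (w = tail G e) - of_bool (w = head G e) :: 'f)"
    using path_flow[of "S - {e}"] joined_sym[OF assms(3)] assms(1) by blast
  then have "c \<in> flows_on G S (\<lambda>w. of_bool (w = tail G e) - of_bool (w = head G e) :: 'f)"
    using flows_on_mono[of "S - {e}" S] by blast
  moreover have "(\<lambda>e'. of_bool (e' = e)) \<in> flows_on G S (\<lambda>w. of_bool (w = head G e) - of_bool (w = tail G e) :: 'f)"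
    using assms boundary_unit[of e] by (auto simp: flows_on_def coord_space_def)
  ultimately have "(\<lambda>e'. c e' + 1 * of_bool (e' = e)) \<in> cycle_space G S"
    by (rule back_subst[of "\<lambda>b. _ \<in> flows_on G S b", OF flows_on_combine]) (simp add: fun_eq_iff)
  moreover have "c e = 0"
    using c by (simp add: flows_on_def coord_space_def)
  ultimately show ?thesis by force
qed

text \<open>
  Among the edges of \<open>S\<close>, only \<open>e\<close> leaves the component of its tail in \<open>S - {e}\<close>. Summing the
  boundary of \<open>z\<close> over that component therefore isolates \<open>- z e\<close>.
\<close>
lemma cycle_zero_on_bridge:
  assumes "S \<subseteq> arcs G" "e \<in> S" "(tail G e, head G e) \<notin> joined G (S - {e})"
    and "z \<in> cycle_space G S"
  shows "z e = 0"
proof -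
  let ?U = "joined G (S - {e}) `` {tail G e}"
  have U: "?U \<subseteq> verts G"
    using assms(1,2) joined_in_verts[of "S - {e}" "tail G e"] tail_in_verts[of e]
    unfolding Image_singleton by blast
  have "z e' * (of_bool (head G e' \<in> ?U) - of_bool (tail G e' \<in> ?U)) = (if e' = e then - z e else 0)" for e'
  proof (cases "e' \<in> S - {e}")
    case True
    then have "head G e' \<in> ?U \<longleftrightarrow> tail G e' \<in> ?U"
      using joined_edge[OF True, of G] joined_sym joined_trans by (metis Image_singleton_iff)
    then show ?thesis using True by simp
  next
    case False
    then show ?thesis
      using assms(3,4) by (auto simp: flows_on_def coord_space_def)
  qed
  then have "(\<Sum>v\<in>?U. boundary G z v) = - z e"
    using assms(1,2) by (simp add: sum_boundary[OF U] sum.delta subset_iff)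
  then show ?thesis
    using assms(4) by (simp add: flows_on_def)
qed

end

section \<open>Dimension of spaces of flows\<close>

context fin_digraph
begin

lemma cycle_space_subspace: "fun_space.subspace (cycle_space G S)"
  unfolding fun_space.subspace_def
proof (intro conjI ballI allI)
  show "0 \<in> cycle_space G S"
    using boundary_zero by (simp add: flows_on_def coord_space_def zero_fun_def)
next
  fix x y :: "'b \<Rightarrow> 'c" assume "x \<in> cycle_space G S" "y \<in> cycle_space G S"
  from flows_on_combine[OF this, of 1] show "x + y \<in> cycle_space G S"
    by (simp add: plus_fun_def zero_fun_def)
next
  fix a :: 'c and x :: "'b \<Rightarrow> 'c" assume x: "x \<in> cycle_space G S"
  have "(\<lambda>_. 0) \<in> cycle_space G S"
    using boundary_zero by (simp add: flows_on_def coord_space_def)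
  from flows_on_combine[OF this x, of a] show "fun_scale a x \<in> cycle_space G S"
    by (simp add: fun_scale_def zero_fun_def)
qed

text \<open>
  Add the edges one at a time. An edge whose ends are already joined enlarges the basis by a
  circulation through it and keeps the components; any other edge carries no circulation and
  reduces the number of components by one. Either way both sides of the equation stay equal.
\<close>
lemma cycle_space_basis:
  assumes "S \<subseteq> arcs G"
  shows "\<exists>B :: ('b \<Rightarrow> 'f::field) set. finite B \<and> fun_space.independent B \<and>
    fun_space.span B = cycle_space G S \<and> card B + card (verts G) = card S + num_comps G S"
  using finite_subset[OF assms finite_arcs] assms
proof (induction S rule: finite_induct)
  case empty
  have "cycle_space G {} = {0 :: 'b \<Rightarrow> 'f}"
    using boundary_zero by (auto simp: flows_on_def coord_space_def zero_fun_def)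
  moreover have "num_comps G {} = card (verts G)"
    unfolding num_comps_def comp_partition_eq_classes[OF empty.prems] joined_empty
    by (rule card_image) (auto simp: inj_on_def)
  ultimately show ?case
    by (intro exI[of _ "{}"]) (simp add: fun_space.independent_empty)
next
  case (insert e S)
  then obtain B :: "('b \<Rightarrow> 'f) set" where B: "finite B" "fun_space.independent B"
      "fun_space.span B = cycle_space G S" "card B + card (verts G) = card S + num_comps G S"
    by auto
  have S: "insert e S - {e} = S"
    using insert.hyps(2) by simp
  have off_e: "x \<in> flows_on G (insert e S) b \<Longrightarrow> x e = 0 \<Longrightarrow> x \<in> flows_on G S b" for x :: "'b \<Rightarrow> 'f" and b
    by (auto simp: flows_on_def coord_space_def)
  show ?case
  proof (cases "(tail G e, head G e) \<in> joined G S")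
    case True
    then obtain z :: "'b \<Rightarrow> 'f" where z: "z \<in> cycle_space G (insert e S)" "z e = 1"
      using joined_without_edge_imp_cycle[of "insert e S" e] insert.prems S by auto
    have "z \<notin> fun_space.span B"
      using z(2) insert.hyps(2) by (auto simp: B(3) flows_on_def coord_space_def)
    moreover have "fun_space.span (insert z B) = cycle_space G (insert e S)"
    proof (intro set_eqI iffI)
      fix x :: "'b \<Rightarrow> 'f" assume "x \<in> fun_space.span (insert z B)"
      moreover have "insert z B \<subseteq> cycle_space G (insert e S)"
        using z(1) fun_space.span_superset[of B] flows_on_mono[of S "insert e S" G "\<lambda>_. 0"] unfolding B(3) by blast
      ultimately show "x \<in> cycle_space G (insert e S)"
        using fun_space.span_minimal[OF _ cycle_space_subspace] by blast
    next
      fix x :: "'b \<Rightarrow> 'f" assume x: "x \<in> cycle_space G (insert e S)"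
      have "x - fun_scale (x e) z \<in> cycle_space G (insert e S)"
        using x z(1) by (intro fun_space.subspace_diff fun_space.subspace_scale cycle_space_subspace)
      then have "x - fun_scale (x e) z \<in> cycle_space G S"
        by (rule off_e) (simp add: fun_scale_def z(2))
      then show "x \<in> fun_space.span (insert z B)"
        unfolding fun_space.span_breakdown_eq B(3) by blast
    qed
    moreover have "num_comps G (insert e S) = num_comps G S"
      using insert.prems
      by (simp add: num_comps_def comp_partition_eq_classes joined_insert_redundant[OF True])
    moreover have "z \<notin> B"
      using calculation(1) fun_space.span_base by blast
    ultimately show ?thesis
      using B insert.hyps
      by (intro exI[of _ "insert z B"]) (simp add: fun_space.independent_insertI)
  next
    case False
    have "x e = 0" if "x \<in> cycle_space G (insert e S)" for x :: "'b \<Rightarrow> 'f"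
      using cycle_zero_on_bridge[OF insert.prems, of e x] False that S by simp
    then have "cycle_space G (insert e S) = (cycle_space G S :: ('b \<Rightarrow> 'f) set)"
      using off_e flows_on_mono[of S "insert e S" G "\<lambda>_. 0"] by blast
    moreover have "num_comps G S = num_comps G (insert e S) + 1"
      unfolding num_comps_def by (rule card_comp_partition_insert[OF insert.prems False])
    ultimately show ?thesis
      using B insert.hyps by (intro exI[of _ B]) simp
  qed
qed

lemma flows_on_diff:
  assumes "x \<in> flows_on G S b" "y \<in> flows_on G S b"
  shows "x - y \<in> cycle_space G S"
  using flows_on_combine[OF assms, of "- 1"] by (simp add: fun_diff_def zero_fun_def)

lemma flows_on_translate:
  assumes "x \<in> flows_on G S b" "z \<in> cycle_space G S"
  shows "x + z \<in> flows_on G S b"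
  using flows_on_combine[OF assms, of 1] by (simp add: plus_fun_def)

lemma aff_dimension_flows_on:
  fixes b :: "'a \<Rightarrow> 'f::field"
  assumes "S \<subseteq> arcs G" "flows_on G S b \<noteq> {}"
  shows "aff_dimension (flows_on G S b) = nullity G S"
proof -
  obtain c where c: "c \<in> flows_on G S b"
    using assms(2) by blast
  have "z \<in> {x - y |x y. x \<in> flows_on G S b \<and> y \<in> flows_on G S b}" if "z \<in> cycle_space G S" for z
  proof -
    have "z = (c + z) - c"
      by simp
    then show ?thesis
      using flows_on_translate[OF c that] c by blast
  qed
  then have dirs: "{x - y |x y. x \<in> flows_on G S b \<and> y \<in> flows_on G S b} = cycle_space G S"
    using flows_on_diff by blast
  obtain B :: "('b \<Rightarrow> 'f) set" where B: "fun_space.independent B" "fun_space.span B = cycle_space G S"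
      "card B + card (verts G) = card S + num_comps G S"
    using cycle_space_basis[OF assms(1)] by blast
  have "fun_space.span B = fun_space.span (cycle_space G S)"
    unfolding B(2)[symmetric] fun_space.span_span ..
  then have "fun_space.dim (cycle_space G S :: ('b \<Rightarrow> 'f) set) = card B"
    using B(1) by (rule fun_space.dim_eq_card)
  then show ?thesis
    using B(3) by (simp add: aff_dimension_def dirs nullity_def)
qed

text \<open>
  Nonempty sets of flows are translates of spaces of circulations, so one that meets another lies
  in it as soon as its directions do. On the right, \<open>b\<close> enters only through the existence of a flow;
  this transfers the order on flats from one boundary to another.
\<close>
lemma flows_on_subset_iff:
  fixes b :: "'a \<Rightarrow> 'f::field"
  assumes "flows_on G S b \<noteq> {}"
  shows "flows_on G S b \<subseteq> flows_on G S' b \<longleftrightarrow>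
    flows_on G (S \<inter> S') b \<noteq> {} \<and> cycle_space G S \<subseteq> (cycle_space G S' :: ('b \<Rightarrow> 'f) set)"
proof (intro iffI conjI subsetI)
  assume sub: "flows_on G S b \<subseteq> flows_on G S' b"
  then show "flows_on G (S \<inter> S') b \<noteq> {}"
    using assms by (simp add: flows_on_Int[symmetric] Int_absorb2)
  fix z :: "'b \<Rightarrow> 'f" assume z: "z \<in> cycle_space G S"
  obtain c where c: "c \<in> flows_on G S b"
    using assms by blast
  have "(c + z) - c \<in> cycle_space G S'"
    using flows_on_translate[OF c z] c sub by (intro flows_on_diff) auto
  then show "z \<in> cycle_space G S'"
    by simp
next
  fix x assume *: "flows_on G (S \<inter> S') b \<noteq> {} \<and> cycle_space G S \<subseteq> (cycle_space G S' :: ('b \<Rightarrow> 'f) set)"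
    and x: "x \<in> flows_on G S b"
  then obtain c where c: "c \<in> flows_on G S b" "c \<in> flows_on G S' b"
    by (auto simp: flows_on_Int[symmetric])
  have "c + (x - c) \<in> flows_on G S' b"
    using flows_on_diff[OF x c(1)] * c(2) by (intro flows_on_translate) auto
  then show "x \<in> flows_on G S' b"
    by simp
qed

section \<open>Cut-edges\<close>

text \<open>
  Walk around the cycle from one end of \<open>e\<close> to the other, using the other edges.
\<close>
lemma undirected_cycle_imp_joined:
  assumes cyc: "undirected_cycle G vs es" and "e \<in> set es"
  shows "(tail G e, head G e) \<in> joined G (arcs G - {e})"
proof -
  define k where "k = length es"
  obtain i where i: "i < k" "es ! i = e"
    using assms(2) by (auto simp: in_set_conv_nth k_def)
  have k: "k > 0"
    using i by simp
  have ends: "{tail G (es ! j), head G (es ! j)} = {vs ! j, vs ! (Suc j mod k)}" if "j < k" for j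
    using cyc that by (simp add: undirected_cycle_def k_def)
  \<comment> \<open>The \<open>l\<close> edges after \<open>e\<close> differ from \<open>e\<close> as long as \<open>l < k\<close>.\<close>
  have "(vs ! (Suc i mod k), vs ! (Suc (i + l) mod k)) \<in> joined G (arcs G - {e})" if "l < k" for l
    using that
  proof (induction l)
    case 0
    then show ?case by simp
  next
    case (Suc l)
    let ?j = "Suc (i + l) mod k"
    have j: "?j < k"
      using k by simp
    have "?j \<noteq> i"
    proof (cases "Suc (i + l) < k")
      case False
      then have "?j = Suc (i + l) - k"
        using i Suc.prems by (simp add: le_mod_geq)
      then show ?thesis
        using Suc.prems False by simp
    qed simp
    then have "es ! ?j \<noteq> e"
      using cyc i j nth_eq_iff_index_eq[of es ?j i] by (auto simp: undirected_cycle_def k_def)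
    moreover have "es ! ?j \<in> arcs G"
      using cyc j nth_mem[of ?j es] by (auto simp: undirected_cycle_def k_def)
    ultimately have "(tail G (es ! ?j), head G (es ! ?j)) \<in> joined G (arcs G - {e})"
      by (intro joined_edge) simp
    moreover have "Suc ?j mod k = Suc (i + Suc l) mod k"
      by (simp add: mod_Suc_eq)
    ultimately have "(vs ! ?j, vs ! (Suc (i + Suc l) mod k)) \<in> joined G (arcs G - {e})"
      using ends[OF j] joined_sym[of "tail G (es ! ?j)" "head G (es ! ?j)"]
      by (auto simp: doubleton_eq_iff)
    then show ?case
      using Suc by (meson Suc_lessD joined_trans)
  qed
  from this[of "k - 1"] have "(vs ! (Suc i mod k), vs ! i) \<in> joined G (arcs G - {e})"
    using i k by simp
  then show ?thesis
    using ends[OF i(1)] i(2) joined_sym by (fastforce simp: doubleton_eq_iff)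
qed

text \<open>
  A shortest walk between the ends of \<open>e\<close> repeats no vertex, hence no edge, and \<open>e\<close> closes it. The
  length \<open>0\<close> is allowed: then \<open>e\<close> is a loop and the cycle consists of \<open>e\<close> alone.
\<close>
lemma joined_imp_undirected_cycle:
  assumes "e \<in> arcs G" "(tail G e, head G e) \<in> joined G (arcs G - {e})"
  shows "\<exists>vs es. undirected_cycle G vs es \<and> e \<in> set es"
proof -
  let ?R = "links G (arcs G - {e})"
  define n where "n = (LEAST n. (tail G e, head G e) \<in> ?R ^^ n)"
  have "\<exists>n. (tail G e, head G e) \<in> ?R ^^ n"
    using assms(2) unfolding joined_def by (rule rtrancl_imp_relpow)
  then have "(tail G e, head G e) \<in> ?R ^^ n"
    unfolding n_def by (rule LeastI_ex)
  then obtain f where f: "f 0 = tail G e" "f n = head G e" "\<And>i. i < n \<Longrightarrow> (f i, f (Suc i)) \<in> ?R"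
    unfolding relpow_fun_conv by blast
  have sub: "(f i, f (i + d)) \<in> ?R ^^ d" if "i + d \<le> n" for i d
    unfolding relpow_fun_conv using that f(3) by (intro exI[of _ "\<lambda>j. f (i + j)"]) auto
  \<comment> \<open>A repeated vertex would allow the part of the walk between its occurrences to be cut out.\<close>
  have neq: "f i \<noteq> f j" if "i < j" "j \<le> n" for i j
  proof
    assume eq: "f i = f j"
    have "(f 0, f i) \<in> ?R ^^ i" "(f j, f n) \<in> ?R ^^ (n - j)"
      using sub[of 0 i] sub[of j "n - j"] that by auto
    then have "(tail G e, head G e) \<in> ?R ^^ (i + (n - j))"
      unfolding relpow_add using f(1,2) eq by auto
    then have "n \<le> i + (n - j)"
      unfolding n_def by (rule Least_le)
    then show False
      using that by simp
  qed
  then have inj: "f i = f j \<longleftrightarrow> i = j" if "i \<le> n" "j \<le> n" for i j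
    using that by (metis linorder_neqE_nat)
  have "\<forall>i. \<exists>a. i < n \<longrightarrow> a \<in> arcs G - {e} \<and> {tail G a, head G a} = {f i, f (Suc i)}"
    using f(3) by (fastforce simp: links_def)
  then obtain g where g: "\<And>i. i < n \<Longrightarrow> g i \<in> arcs G - {e} \<and> {tail G (g i), head G (g i)} = {f i, f (Suc i)}"
    by metis
  define vs es where "vs = map f [0..<Suc n]" and "es = map g [0..<n] @ [e]"
  have "distinct vs"
    unfolding vs_def distinct_map using inj by (auto simp: inj_on_def)
  moreover have "inj_on g {0..<n}"
  proof (rule inj_onI)
    fix i j assume "i \<in> {0..<n}" "j \<in> {0..<n}" "g i = g j"
    then have eq: "{f i, f (Suc i)} = {f j, f (Suc j)}" and ij: "i < n" "j < n"
      using g[of i] g[of j] by simp_all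
    show "i = j"
      using eq inj[of i j] inj[of i "Suc j"] inj[of "Suc i" j] ij
      by (auto simp: doubleton_eq_iff)
  qed
  moreover have "e \<notin> g ` {0..<n}"
    using g by force
  ultimately have "distinct vs" "distinct es"
    by (simp_all add: es_def distinct_map)
  moreover have "{tail G (es ! i), head G (es ! i)} = {vs ! i, vs ! (Suc i mod length es)}" if "i < length es" for i
  proof (cases "i < n")
    case True
    then have "es ! i = g i" "vs ! i = f i" "vs ! (Suc i mod length es) = f (Suc i)"
      unfolding es_def vs_def by (auto simp: nth_append simp del: upt_Suc)
    then show ?thesis
      using g[OF True] by simp
  next
    case False
    then have "i = n"
      using that by (simp add: es_def)
    then have "es ! i = e" "vs ! i = f n" "vs ! (Suc i mod length es) = f 0"
      unfolding es_def vs_def by (auto simp: nth_append simp del: upt_Suc)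
    then show ?thesis
      using f(1,2) by auto
  qed
  moreover have "set es \<subseteq> arcs G"
    using g assms(1) by (auto simp: es_def)
  ultimately have "undirected_cycle G vs es"
    unfolding undirected_cycle_def by (simp add: es_def vs_def)
  moreover have "e \<in> set es"
    by (simp add: es_def)
  ultimately show ?thesis
    by blast
qed

lemma cut_edges_iff:
  "e \<in> cut_edges G \<longleftrightarrow> e \<in> arcs G \<and> (tail G e, head G e) \<notin> joined G (arcs G - {e})"
  unfolding cut_edges_def using undirected_cycle_imp_joined joined_imp_undirected_cycle by blast

end

section \<open>The arrangement of coordinate hyperplanes in a space of flows\<close>

lemma rev_incl_isomorphic_images:
  assumes "\<And>i j. i \<in> I \<Longrightarrow> j \<in> I \<Longrightarrow> X i \<subseteq> X j \<longleftrightarrow> Y i \<subseteq> Y j"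
  shows "rev_incl_isomorphic (X ` I) (Y ` I)"
proof -
  let ?f = "\<lambda>A. Y (inv_into I X A)"
  have eq: "X i = X j \<longleftrightarrow> Y i = Y j" if "i \<in> I" "j \<in> I" for i j
    using assms[OF that] assms[OF that(2,1)] by blast
  have inv: "inv_into I X (X i) \<in> I" "X (inv_into I X (X i)) = X i" if "i \<in> I" for i
    using that by (simp_all add: inv_into_into f_inv_into_f)
  have f: "?f (X i) = Y i" if "i \<in> I" for i
    using eq[OF inv(1)[OF that] that] inv(2)[OF that] by simp
  have "?f ` (X ` I) = Y ` I"
    using f by (auto simp: image_image)
  moreover have "inj_on ?f (X ` I)"
    using f eq by (auto simp: inj_on_def)
  moreover have "\<forall>A\<in>X ` I. \<forall>B\<in>X ` I. A \<supseteq> B \<longleftrightarrow> ?f A \<supseteq> ?f B"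
    using f assms by auto
  ultimately show ?thesis
    unfolding rev_incl_isomorphic_def bij_betw_def by blast
qed

text \<open>
  The index set \<open>K\<close> covers both arrangements of the theorem: \<open>K = arcs G\<close> gives \<open>flow_arr\<close>, and the
  edges that are not cut-edges give \<open>flow_arr_proper\<close>. The hyperplane of \<open>e\<close> is written as a set of
  flows with restricted support, so that intersections only intersect supports.
\<close>
definition edge_arr ::
    "('v,'e) pre_digraph \<Rightarrow> 'e set \<Rightarrow> ('v \<Rightarrow> 'f::field) \<Rightarrow> ('e \<Rightarrow> 'f) set set" where
  "edge_arr G K b = (\<lambda>e. flows_on G (arcs G - {e}) b) ` {e \<in> K. flows_on G (arcs G - {e}) b \<noteq> {}}"

lemma flows_Int_hyperplanes:
  "flows G b \<inter> \<Inter> ((\<lambda>e. flows_on G (arcs G - {e}) b) ` T) = flows_on G (arcs G - T) b"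
  by (auto simp: flows_on_arcs[symmetric] flows_on_def coord_space_def)

lemma flows_on_Diff_nonempty_imp:
  "flows_on G (arcs G - T) b \<noteq> {} \<Longrightarrow> e \<in> T \<Longrightarrow> flows_on G (arcs G - {e}) b \<noteq> {}"
  using flows_on_mono[of "arcs G - T" "arcs G - {e}" G b] by blast

text \<open>
  A nonempty flat lies in the hyperplane of every edge of \<open>T\<close>, so none of these hyperplanes is
  empty and each of them belongs to the arrangement.
\<close>
lemma arr_flats_edge_arr:
  "arr_flats (flows G b) (edge_arr G K b) =
    (\<lambda>T. flows_on G (arcs G - T) b) ` {T. T \<subseteq> K \<and> flows_on G (arcs G - T) b \<noteq> {}}"
  (is "?L = ?R")
proof (intro set_eqI iffI)
  fix X assume "X \<in> ?L"
  then obtain B where B: "B \<subseteq> edge_arr G K b" "X = flows G b \<inter> \<Inter>B" "X \<noteq> {}"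
    by (auto simp: arr_flats_def)
  then obtain T where T: "T \<subseteq> {e \<in> K. flows_on G (arcs G - {e}) b \<noteq> {}}"
      "B = (\<lambda>e. flows_on G (arcs G - {e}) b) ` T"
    unfolding edge_arr_def by (meson subset_image_iff)
  then have "X = flows_on G (arcs G - T) b"
    using B(2) by (simp only: flows_Int_hyperplanes)
  then show "X \<in> ?R"
    using T(1) B(3) by auto
next
  fix X assume "X \<in> ?R"
  then obtain T where T: "T \<subseteq> K" "X = flows_on G (arcs G - T) b" "X \<noteq> {}"
    by auto
  have "(\<lambda>e. flows_on G (arcs G - {e}) b) ` T \<subseteq> edge_arr G K b"
    using T flows_on_Diff_nonempty_imp[where G = G and T = T and b = b] by (auto simp: edge_arr_def)
  then show "X \<in> ?L"
    using T(2,3) unfolding arr_flats_def flows_Int_hyperplanes[symmetric, where G = G and b = b and T = T] by blast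
qed

context fin_digraph
begin

lemma rev_incl_isomorphic_edge_arr:
  fixes b b' :: "'a \<Rightarrow> 'f::field"
  assumes "\<And>T. T \<subseteq> K \<Longrightarrow> flows_on G (arcs G - T) b \<noteq> {} \<longleftrightarrow> flows_on G (arcs G - T) b' \<noteq> {}"
  shows "rev_incl_isomorphic (arr_flats (flows G b) (edge_arr G K b))
    (arr_flats (flows G b') (edge_arr G K b'))"
proof -
  let ?I = "{T. T \<subseteq> K \<and> flows_on G (arcs G - T) b \<noteq> {}}"
  have I: "{T. T \<subseteq> K \<and> flows_on G (arcs G - T) b' \<noteq> {}} = ?I"
    using assms by auto
  have "flows_on G (arcs G - T) b \<subseteq> flows_on G (arcs G - U) b \<longleftrightarrow>
      flows_on G (arcs G - T) b' \<subseteq> flows_on G (arcs G - U) b'" if T: "T \<in> ?I" and U: "U \<in> ?I" for T U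
  proof -
    have "(arcs G - T) \<inter> (arcs G - U) = arcs G - (T \<union> U)"
      by blast
    moreover have "T \<union> U \<subseteq> K"
      using T U by blast
    moreover have "flows_on G (arcs G - T) b \<noteq> {}" "flows_on G (arcs G - T) b' \<noteq> {}"
      using T assms by auto
    ultimately show ?thesis
      using assms[of "T \<union> U"] by (simp add: flows_on_subset_iff)
  qed
  then show ?thesis
    unfolding arr_flats_edge_arr I by (rule rev_incl_isomorphic_images)
qed

lemma arr_chi_edge_arr:
  fixes b :: "'a \<Rightarrow> 'f::field"
  assumes "K \<subseteq> arcs G"
  shows "arr_chi (flows G b) (edge_arr G K b) =
    (\<Sum>T | T \<subseteq> K \<and> flows_on G (arcs G - T) b \<noteq> {}. monom ((- 1) ^ card T) (nullity G (arcs G - T)))"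
proof -
  let ?h = "\<lambda>e. flows_on G (arcs G - {e}) b"
  define K' where "K' = {e \<in> K. ?h e \<noteq> {}}"
  \<comment> \<open>Extended by \<open>0\<close> to empty intersections, the summand is a function on all subsets.\<close>
  define g where "g B = (if flows G b \<inter> \<Inter>B \<noteq> {} then monom (1::int) (aff_dimension (flows G b \<inter> \<Inter>B)) else 0)" for B
  have signed: "monom ((- 1) ^ k) n = (- 1) ^ k * monom (1::int) n" for k n
    by (cases "even k") (simp_all add: minus_monom)
  have fin: "finite K" "finite K'"
    using finite_subset[OF assms finite_arcs] by (simp_all add: K'_def)
  have A: "edge_arr G K b = ?h ` K'"
    by (simp add: edge_arr_def K'_def)
  have "arr_chi (flows G b) (edge_arr G K b) = (\<Sum>B\<in>Pow (?h ` K'). (- 1) ^ card B * g B)"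
    unfolding arr_chi_def A using fin
    by (intro sum.mono_neutral_cong_left) (auto simp: g_def signed)
  also have "\<dots> = (\<Sum>T\<in>Pow K'. (- 1) ^ card T * g (?h ` T))"
    using fin(2) by (rule signed_sum_Pow_image)
  also have "\<dots> = (\<Sum>T | T \<subseteq> K \<and> flows_on G (arcs G - T) b \<noteq> {}. monom ((- 1) ^ card T) (nullity G (arcs G - T)))"
  proof (rule sum.mono_neutral_cong_right)
    show "{T. T \<subseteq> K \<and> flows_on G (arcs G - T) b \<noteq> {}} \<subseteq> Pow K'"
      using flows_on_Diff_nonempty_imp by (force simp: K'_def)
    show "\<forall>T\<in>Pow K' - {T. T \<subseteq> K \<and> flows_on G (arcs G - T) b \<noteq> {}}. (- 1) ^ card T * g (?h ` T) = 0"
      unfolding g_def flows_Int_hyperplanes by (auto simp: K'_def)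
    show "(- 1) ^ card T * g (?h ` T) = monom ((- 1) ^ card T) (nullity G (arcs G - T))"
      if "T \<in> {T. T \<subseteq> K \<and> flows_on G (arcs G - T) b \<noteq> {}}" for T
      using that aff_dimension_flows_on[of "arcs G - T" b]
      unfolding g_def flows_Int_hyperplanes signed by simp
  qed (use fin in simp)
  finally show ?thesis .
qed

lemma arr_chi_edge_arr_eq_phi:
  fixes b :: "'a \<Rightarrow> 'f::field"
  assumes "K \<subseteq> arcs G"
    and P: "\<And>S. S \<subseteq> arcs G \<Longrightarrow> comp_partition G S \<in> P \<longleftrightarrow> arcs G - S \<subseteq> K \<and> flows_on G S b \<noteq> {}"
  shows "arr_chi (flows G b) (edge_arr G K b) = phi G P"
  unfolding arr_chi_edge_arr[OF assms(1)] phi_def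
proof (rule sum.reindex_bij_witness[of _ "\<lambda>S. arcs G - S" "\<lambda>T. arcs G - T"])
  fix T assume T: "T \<in> {T. T \<subseteq> K \<and> flows_on G (arcs G - T) b \<noteq> {}}"
  then have TT: "arcs G - (arcs G - T) = T"
    using assms(1) by blast
  then show "arcs G - (arcs G - T) = T"
    and "monom ((- 1) ^ card (arcs G - (arcs G - T))) (nullity G (arcs G - T))
      = monom ((- 1) ^ card T) (nullity G (arcs G - T))"
    by simp_all
  show "arcs G - T \<in> {S. S \<subseteq> arcs G \<and> comp_partition G S \<in> P}"
    using T TT by (simp add: P)
next
  fix S assume S: "S \<in> {S. S \<subseteq> arcs G \<and> comp_partition G S \<in> P}"
  then show "arcs G - (arcs G - S) = S"
    by blast
  with S show "arcs G - S \<in> {T. T \<subseteq> K \<and> flows_on G (arcs G - T) b \<noteq> {}}"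
    using P[of S] by simp
qed

lemma coord_hyperplane_Int_flows:
  "coord_hyperplane G e \<inter> flows G b = flows_on G (arcs G - {e}) b"
  by (auto simp: coord_hyperplane_def flows_def flows_on_def coord_space_def)

lemma flow_arr_eq_edge_arr: "flow_arr G b = edge_arr G (arcs G) b"
  unfolding flow_arr_def edge_arr_def coord_hyperplane_Int_flows by blast

lemma flow_arr_proper_eq_edge_arr:
  fixes b :: "'a \<Rightarrow> 'f::field"
  assumes "b \<in> boundaries G"
  shows "flow_arr_proper G b = edge_arr G (arcs G - cut_edges G) b"
proof -
  have whole_iff: "flows_on G (arcs G - {e}) b = flows G b \<longleftrightarrow> e \<in> cut_edges G"
    if e: "e \<in> arcs G" and ne: "flows_on G (arcs G - {e}) b \<noteq> {}" for e
  proof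
    assume whole: "flows_on G (arcs G - {e}) b = flows G b"
    show "e \<in> cut_edges G"
    proof (rule ccontr)
      assume "e \<notin> cut_edges G"
      then obtain z :: "'b \<Rightarrow> 'f" where z: "z \<in> cycle_space G (arcs G)" "z e = 1"
        using joined_without_edge_imp_cycle[of "arcs G" e] e by (auto simp: cut_edges_iff)
      obtain c where c: "c \<in> flows_on G (arcs G - {e}) b"
        using ne by blast
      then have "c + z \<in> flows_on G (arcs G - {e}) b"
        using z(1) unfolding whole flows_on_arcs[symmetric] by (intro flows_on_translate)
      then show False
        using c z(2) by (simp add: flows_on_def coord_space_def)
    qed
  next
    assume cut: "e \<in> cut_edges G"
    obtain c where c: "c \<in> flows_on G (arcs G - {e}) b"
      using ne by blast
    have "x \<in> flows_on G (arcs G - {e}) b" if x: "x \<in> flows_on G (arcs G) b" for x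
    proof -
      have "c \<in> flows_on G (arcs G) b"
        using c flows_on_mono[of "arcs G - {e}" "arcs G" G b] by blast
      then have "(x - c) e = 0"
        using cut e by (intro cycle_zero_on_bridge[of "arcs G"] flows_on_diff[OF x]) (auto simp: cut_edges_iff)
      then show ?thesis
        using c x by (auto simp: flows_on_def coord_space_def)
    qed
    then show "flows_on G (arcs G - {e}) b = flows G b"
      unfolding flows_on_arcs[symmetric] using flows_on_mono[of "arcs G - {e}" "arcs G" G b] by blast
  qed
  show ?thesis
    unfolding flow_arr_proper_def flow_arr_eq_edge_arr edge_arr_def using whole_iff by auto
qed

section \<open>Boundary hyperplanes determine all boundary subspaces\<close>

lemma boundaries_imp_flow: "b \<in> boundaries G \<Longrightarrow> flows_on G (arcs G) b \<noteq> {}"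
  by (auto simp: boundaries_def flows_on_def)

text \<open>
  An edge set with one component more than \<open>G\<close> corresponds to a boundary hyperplane, so this says
  that, among boundaries, each \<open>B\<^bsub>\<pi>(S)\<^esub>\<close> is an intersection of hyperplanes \<open>B\<^bsub>\<pi>(S')\<^esub>\<close> with \<open>S \<subseteq> S'\<close>. Passing only
  to larger edge sets is essential: if \<open>S\<close> contains all cut-edges, so does \<open>S'\<close>.
\<close>
lemma flow_from_corank_one:
  fixes b :: "'a \<Rightarrow> 'f::field"
  assumes S: "S \<subseteq> arcs G" and b: "b \<in> boundaries G"
    and corank1: "\<And>S'. S \<subseteq> S' \<Longrightarrow> S' \<subseteq> arcs G \<Longrightarrow>
      card (comp_partition G S') = card (comp_partition G (arcs G)) + 1 \<Longrightarrow> flows_on G S' b \<noteq> {}"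
  shows "flows_on G S b \<noteq> {}"
proof -
  let ?P = "\<lambda>T. T \<subseteq> arcs G - S \<and> joined G (S \<union> T) = joined G (arcs G)"
  have "?P (arcs G - S)"
    using S by (simp add: Un_absorb1)
  from ex_has_least_nat[of ?P, OF this, of card]
  obtain T where T: "?P T" and minimal: "\<And>T'. ?P T' \<Longrightarrow> card T \<le> card T'"
    by meson
  have ST: "S \<union> T \<subseteq> arcs G"
    using S T by blast
  have "comp_partition G (S \<union> T) = comp_partition G (arcs G)"
    using T ST by (simp add: comp_partition_eq_classes)
  then have "flows_on G (S \<union> T) b \<noteq> {}"
    using B_part_comp_partition_iff[OF ST, of b] B_part_comp_partition_iff[OF order_refl, of b]
      boundaries_imp_flow[OF b] by simp
  then obtain c where c: "c \<in> flows_on G (S \<union> T) b"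
    by blast
  \<comment> \<open>Some flow avoids \<open>e\<close>, and flows on \<open>S \<union> T\<close> cannot differ at the bridge \<open>e\<close>.\<close>
  have "c e = 0" if e: "e \<in> T" for e
  proof -
    let ?S' = "S \<union> T - {e}"
    have S': "insert e ?S' = S \<union> T" "?S' = S \<union> (T - {e})"
      using e T by auto
    have bridge: "(tail G e, head G e) \<notin> joined G ?S'"
    proof
      assume "(tail G e, head G e) \<in> joined G ?S'"
      from joined_insert_redundant[OF this] have "joined G ?S' = joined G (arcs G)"
        using T unfolding S'(1) by simp
      then have "joined G (S \<union> (T - {e})) = joined G (arcs G)"
        unfolding S'(2) .
      then have "card T \<le> card (T - {e})"
        using T by (intro minimal) blast
      moreover have "finite T"
        using ST finite_subset[OF _ finite_arcs] by blast
      ultimately show False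
        using e by (metis card_Diff1_less not_less)
    qed
    have "card (comp_partition G ?S') = card (comp_partition G (arcs G)) + 1"
      using card_comp_partition_insert[of e ?S'] bridge ST \<open>comp_partition G (S \<union> T) = _\<close>
      unfolding S'(1) by simp
    then obtain c' where c': "c' \<in> flows_on G ?S' b"
      using corank1[of ?S'] ST e T by blast
    then have "c' \<in> flows_on G (S \<union> T) b"
      using flows_on_mono[of ?S' "S \<union> T" G b] by blast
    then have "(c - c') e = 0"
      using cycle_zero_on_bridge[OF ST, of e] bridge e flows_on_diff[OF c] by blast
    then show ?thesis
      using c' by (simp add: flows_on_def coord_space_def)
  qed
  then have "c \<in> flows_on G S b"
    using c by (auto simp: flows_on_def coord_space_def)
  then show ?thesis
    by blast
qed

end

text \<open>
  A hyperplane of \<open>A\<close> contains all of \<open>X\<close>, or meets \<open>X\<close> in a member of the restriction and misses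
  both points there, or does not meet \<open>X\<close>.
\<close>
lemma arr_compl_restrict_same_members:
  assumes "b1 \<in> arr_compl X (arr_restrict A X)" "b2 \<in> arr_compl X (arr_restrict A X)" "H \<in> A"
  shows "b1 \<in> H \<longleftrightarrow> b2 \<in> H"
  using assms by (auto simp: arr_compl_def arr_restrict_def)

context fin_digraph
begin

lemma flows_on_transfer:
  fixes b1 b2 :: "'a \<Rightarrow> 'f::field"
  assumes "b2 \<in> boundaries G" and "S \<subseteq> arcs G" "C \<subseteq> S" "flows_on G S b1 \<noteq> {}"
    and hyp: "\<And>S'. C \<subseteq> S' \<Longrightarrow> S' \<subseteq> arcs G \<Longrightarrow>
      card (comp_partition G S') = card (comp_partition G (arcs G)) + 1 \<Longrightarrow>
      b1 \<in> B_part G (comp_partition G S') \<Longrightarrow> b2 \<in> B_part G (comp_partition G S')"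
  shows "flows_on G S b2 \<noteq> {}"
proof (rule flow_from_corank_one[OF assms(2,1)])
  fix S' assume S': "S \<subseteq> S'" "S' \<subseteq> arcs G"
      "card (comp_partition G S') = card (comp_partition G (arcs G)) + 1"
  have "flows_on G S' b1 \<noteq> {}"
    using assms(4) flows_on_mono[OF S'(1), of G b1] by blast
  then show "flows_on G S' b2 \<noteq> {}"
    using hyp[of S'] S' assms(3) by (simp add: B_part_comp_partition_iff)
qed

text \<open>
  A cut-edge outside \<open>S\<close> would have its ends in different blocks of \<open>\<pi>(S)\<close>. So whether the cut-edges
  lie in \<open>S\<close> is visible from the partition, although \<open>S\<close> itself is not.
\<close>
lemma comp_partition_in_Partitions_cut_iff:
  assumes "S \<subseteq> arcs G"
  shows "comp_partition G S \<in> Partitions_cut G \<longleftrightarrow> cut_edges G \<subseteq> S"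
proof
  assume "comp_partition G S \<in> Partitions_cut G"
  then obtain S' where S': "S' \<subseteq> arcs G" "cut_edges G \<subseteq> S'" "comp_partition G S = comp_partition G S'"
    by (auto simp: Partitions_cut_def)
  show "cut_edges G \<subseteq> S"
  proof (rule subsetI, rule ccontr)
    fix e assume e: "e \<in> cut_edges G" "e \<notin> S"
    then have "(tail G e, head G e) \<in> joined G S'"
      using S'(2) by (intro joined_edge) blast
    moreover have "tail G e \<in> verts G"
      using e(1) by (simp add: cut_edges_iff)
    ultimately have "(tail G e, head G e) \<in> joined G S"
      using joined_iff_same_block[OF assms] joined_iff_same_block[OF S'(1)] S'(3) by simp
    then have "(tail G e, head G e) \<in> joined G (arcs G - {e})"
      using joined_mono[of S "arcs G - {e}" G] assms e(2) by blast
    then show False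
      using e(1) by (simp add: cut_edges_iff)
  qed
qed (use assms in \<open>auto simp: Partitions_cut_def\<close>)

lemma comp_partition_in_Partitions_at_iff:
  fixes b :: "'a \<Rightarrow> 'f::field"
  assumes "S \<subseteq> arcs G"
  shows "comp_partition G S \<in> Partitions_at G b \<longleftrightarrow> flows_on G S b \<noteq> {}"
  using assms by (auto simp: Partitions_at_def Partitions_def B_part_comp_partition_iff)

lemma comp_partition_in_Partitions_cut_at_iff:
  fixes b :: "'a \<Rightarrow> 'f::field"
  assumes "S \<subseteq> arcs G"
  shows "comp_partition G S \<in> Partitions_cut_at G b \<longleftrightarrow> cut_edges G \<subseteq> S \<and> flows_on G S b \<noteq> {}"
  using assms by (simp add: Partitions_cut_at_def comp_partition_in_Partitions_cut_iff B_part_comp_partition_iff)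

text \<open>
  The common form of both halves of the theorem: \<open>C = {}\<close> with all partitions, or the set \<open>C\<close> of
  cut-edges with the partitions coming from edge sets that contain \<open>C\<close>.
\<close>
lemma edge_arr_invariance:
  fixes b1 b2 :: "'a \<Rightarrow> 'f::field"
  assumes b: "b1 \<in> boundaries G" "b2 \<in> boundaries G" and C: "C \<subseteq> arcs G"
    and X: "b1 \<in> arr_compl X (arr_restrict A X)" "b2 \<in> arr_compl X (arr_restrict A X)"
    and A: "\<And>S. C \<subseteq> S \<Longrightarrow> S \<subseteq> arcs G \<Longrightarrow>
      card (comp_partition G S) = card (comp_partition G (arcs G)) + 1 \<Longrightarrow>
      B_part G (comp_partition G S) \<in> A"
    and P1: "\<And>S. S \<subseteq> arcs G \<Longrightarrow> comp_partition G S \<in> P b1 \<longleftrightarrow> C \<subseteq> S \<and> flows_on G S b1 \<noteq> {}"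
    and P2: "\<And>S. S \<subseteq> arcs G \<Longrightarrow> comp_partition G S \<in> P b2 \<longleftrightarrow> C \<subseteq> S \<and> flows_on G S b2 \<noteq> {}"
    and P: "P b1 \<subseteq> Partitions G" "P b2 \<subseteq> Partitions G"
  defines "arr \<equiv> edge_arr G (arcs G - C)"
  shows "rev_incl_isomorphic (arr_flats (flows G b1) (arr b1)) (arr_flats (flows G b2) (arr b2))
    \<and> P b1 = P b2
    \<and> arr_chi (flows G b1) (arr b1) = arr_chi (flows G b2) (arr b2)
    \<and> arr_chi (flows G b2) (arr b2) = phi G (P b1)
    \<and> phi G (P b1) = phi G (P b2)"
proof -
  have same: "B_part G (comp_partition G S) \<in> A \<Longrightarrow>
      b1 \<in> B_part G (comp_partition G S) \<longleftrightarrow> b2 \<in> B_part G (comp_partition G S)" for S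
    using arr_compl_restrict_same_members[OF X] by blast
  have flow_iff: "flows_on G S b1 \<noteq> {} \<longleftrightarrow> flows_on G S b2 \<noteq> {}" if "S \<subseteq> arcs G" "C \<subseteq> S" for S
    using flows_on_transfer[OF b(2) that, of b1] flows_on_transfer[OF b(1) that, of b2] same A by blast
  have PP: "P b1 = P b2"
  proof (rule set_eqI)
    fix p
    show "p \<in> P b1 \<longleftrightarrow> p \<in> P b2"
    proof (cases "p \<in> Partitions G")
      case True
      then obtain S where "S \<subseteq> arcs G" "p = comp_partition G S"
        by (auto simp: Partitions_def)
      then show ?thesis
        using P1[of S] P2[of S] flow_iff[of S] by blast
    qed (use P in blast)
  qed
  have diff: "arcs G - S \<subseteq> arcs G - C \<longleftrightarrow> C \<subseteq> S" for S
    using C by blast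
  have chi: "arr_chi (flows G b1) (arr b1) = phi G (P b1)" "arr_chi (flows G b2) (arr b2) = phi G (P b2)"
    unfolding arr_def by (rule arr_chi_edge_arr_eq_phi; simp only: diff P1 P2 Diff_subset)+
  have "rev_incl_isomorphic (arr_flats (flows G b1) (arr b1)) (arr_flats (flows G b2) (arr b2))"
    unfolding arr_def using C by (intro rev_incl_isomorphic_edge_arr flow_iff) blast+
  then show ?thesis
    using chi PP by simp
qed

end
theorem theorem2p4:
  fixes G :: "('v, 'e) pre_digraph" and b1 b2 :: "'v \<Rightarrow> 'f::field"
  assumes "fin_digraph G"
    and "b1 \<in> boundaries G" and "b2 \<in> boundaries G"
  shows
    "((\<exists>X \<in> arr_flats (boundaries G) (boundary_arr_cut G).
          b1 \<in> arr_compl X (arr_restrict (boundary_arr_cut G) X) \<and>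
          b2 \<in> arr_compl X (arr_restrict (boundary_arr_cut G) X)) \<longrightarrow>
        rev_incl_isomorphic (arr_flats (flows G b1) (flow_arr_proper G b1))
                            (arr_flats (flows G b2) (flow_arr_proper G b2)) \<and>
        Partitions_cut_at G b1 = Partitions_cut_at G b2 \<and>
        arr_chi (flows G b1) (flow_arr_proper G b1) = arr_chi (flows G b2) (flow_arr_proper G b2) \<and>
        arr_chi (flows G b2) (flow_arr_proper G b2) = phi G (Partitions_cut_at G b1) \<and>
        phi G (Partitions_cut_at G b1) = phi G (Partitions_cut_at G b2))
     \<and>
     ((\<exists>X \<in> arr_flats (boundaries G) (boundary_arr G).
          b1 \<in> arr_compl X (arr_restrict (boundary_arr G) X) \<and>
          b2 \<in> arr_compl X (arr_restrict (boundary_arr G) X)) \<longrightarrow>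
        rev_incl_isomorphic (arr_flats (flows G b1) (flow_arr G b1))
                            (arr_flats (flows G b2) (flow_arr G b2)) \<and>
        Partitions_at G b1 = Partitions_at G b2 \<and>
        arr_chi (flows G b1) (flow_arr G b1) = arr_chi (flows G b2) (flow_arr G b2) \<and>
        arr_chi (flows G b2) (flow_arr G b2) = phi G (Partitions_at G b1) \<and>
        phi G (Partitions_at G b1) = phi G (Partitions_at G b2))"
proof -
  interpret fin_digraph G by fact
  have "rev_incl_isomorphic (arr_flats (flows G b1) (flow_arr_proper G b1))
                            (arr_flats (flows G b2) (flow_arr_proper G b2)) \<and>
        Partitions_cut_at G b1 = Partitions_cut_at G b2 \<and>
        arr_chi (flows G b1) (flow_arr_proper G b1) = arr_chi (flows G b2) (flow_arr_proper G b2) \<and>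
        arr_chi (flows G b2) (flow_arr_proper G b2) = phi G (Partitions_cut_at G b1) \<and>
        phi G (Partitions_cut_at G b1) = phi G (Partitions_cut_at G b2)"
    if X: "b1 \<in> arr_compl X (arr_restrict (boundary_arr_cut G) X)"
      "b2 \<in> arr_compl X (arr_restrict (boundary_arr_cut G) X)" for X
    unfolding flow_arr_proper_eq_edge_arr[OF assms(2)] flow_arr_proper_eq_edge_arr[OF assms(3)]
  proof (rule edge_arr_invariance[OF assms(2,3) _ X, where P = "Partitions_cut_at G"])
    show "cut_edges G \<subseteq> arcs G"
      by (auto simp: cut_edges_def)
    show "Partitions_cut_at G b1 \<subseteq> Partitions G" "Partitions_cut_at G b2 \<subseteq> Partitions G"
      by (auto simp: Partitions_cut_at_def Partitions_cut_def Partitions_def)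
  qed (use comp_partition_in_Partitions_cut_at_iff in
      \<open>auto simp: boundary_arr_cut_def comp_partition_in_Partitions_cut_iff\<close>)
  moreover have "rev_incl_isomorphic (arr_flats (flows G b1) (flow_arr G b1))
                            (arr_flats (flows G b2) (flow_arr G b2)) \<and>
        Partitions_at G b1 = Partitions_at G b2 \<and>
        arr_chi (flows G b1) (flow_arr G b1) = arr_chi (flows G b2) (flow_arr G b2) \<and>
        arr_chi (flows G b2) (flow_arr G b2) = phi G (Partitions_at G b1) \<and>
        phi G (Partitions_at G b1) = phi G (Partitions_at G b2)"
    if X: "b1 \<in> arr_compl X (arr_restrict (boundary_arr G) X)"
      "b2 \<in> arr_compl X (arr_restrict (boundary_arr G) X)" for X
    unfolding flow_arr_eq_edge_arr
  proof (rule edge_arr_invariance[OF assms(2,3) empty_subsetI X, where P = "Partitions_at G", unfolded Diff_empty])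
    show "Partitions_at G b1 \<subseteq> Partitions G" "Partitions_at G b2 \<subseteq> Partitions G"
      by (auto simp: Partitions_at_def)
  qed (use comp_partition_in_Partitions_at_iff in \<open>auto simp: boundary_arr_def Partitions_def\<close>)
  ultimately show ?thesis
    by blast
qed

end
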